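(* Assume AS.1, AS.3, AS.4 and AS.5, and consider a realization of the SKOFFAR$p$ algorithm in which $\mathcal K_1$ occurs. Then $$f(x_{k_1})\le f_{\max}\stackrel{\rm def}{=} f(x_0)+\frac{1}{(p+1)!}\left(\frac{L_p}{\sigma_0}\nu_{\max}+\vartheta\sigma_0\right),$$ where $\sigma_0=\nu_0$ and $$\nu_{\max}=\frac{2L_p}{\vartheta}\left[1+\left(2\eta+2\left(\frac{(p+1)!\,\kappa_g}{\vartheta\nu_0}\right)^{1/p}\right)^{p+1}\right],\qquad \eta=\sum_{i=2}^{p}\left[\frac{\kappa_{\rm high}(p+1)!}{i!\,\vartheta\nu_0}\right]^{\frac{1}{p-i+1}}$$ (with $\eta=0$ when $p=1$).
   Context: Let $f:\mathbb{R}^n\to\mathbb{R}$ and $p\ge1$ an integer; $\|\cdot\|$ is the Euclidean norm for vectors, the spectral norm for matrices and the induced (subordinate) norm for tensors; $T[d]^i$ denotes a symmetric $i$-tensor applied to $i$ copies of $d$. Assumptions: AS.1: $f$ is $p$ times continuously differentiable on $\mathbb{R}^n$. AS.3: there is $L_p\ge 0$ with $\|\nabla^p f(x)-\nabla^p f(y)\|\le L_p\|x-y\|$ for all $x,y$. AS.4: there is $\kappa_g\ge0$ with $\|\nabla f(x)\|\le\kappa_g$ for all $x$. AS.5: if $p>1$ there is $\kappa_{\rm high}\ge0$ with $\min_{\|d\|\le1}\nabla^i f(x)[d]^i\ge-\kappa_{\rm high}$ for all $x$ and $i\in\{2,\dots,p\}$ (set $\kappa_{\rm high}=0$ if $p=1$).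 For $x,s\in\mathbb{R}^n$ let $T_{f,p}(x,s)=f(x)+\sum_{i=1}^p\frac{1}{i!}\nabla^i f(x)[s]^i$. Write $g_k=\nabla f(x_k)$. The SKOFFAR$p$ algorithm: given $x_0\in\mathbb{R}^n$, $\nu_0>0$, $\epsilon\in(0,1]$, $\theta>1$, $\mu_{-1}\ge 0$, $\vartheta\in(0,1)$ and a fixed distribution $\mathcal S$ of $\ell\times n$ random matrices ($\ell<n$), for $k=0,1,2,\dots$: (i) if $k=0$ set $\sigma_0=\nu_0$; otherwise choose $\sigma_k\in[\vartheta\nu_k,\max(\nu_k,\mu_k)]$, where $\mu_k=\max\Big[\mu_{k-1},\frac{\|S_{k-1}g_k\|-\|\nabla_{\hat s}\widehat T_{k-1}(\hat s_{k-1})\|}{\kappa_{S,k-1}\|s_{k-1}\|^p}\Big]$ for some number $\kappa_{S,k-1}\ge\|S_{k-1}\|$; (ii) draw $S_k\in\mathbb{R}^{\ell\times n}$ from $\mathcal S$, define for $\hat s\in\mathbb{R}^\ell$ the sketched Taylor model $\widehat T_k(\hat s)=T_{f,p}(x_k,S_k^T\hat s)$ and the sketched model $\widehat m_k(\hat s)=\widehat T_k(\hat s)+\frac{\sigma_k}{(p+1)!}\|S_k^T\hat s\|^{p+1}$, and compute $\hat s_k\in\mathbb{R}^\ell$ with $\widehat m_k(\hat s_k)<\widehat m_k(0)$ and $\|\nabla_{\hat s}\widehat T_k(\hat s_k)\|\le\theta\frac{\sigma_k}{p!}\|S_k^T\hat s_k\|^{p-1}\|S_kS_k^T\hat s_k\|$;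 set $s_k=S_k^T\hat s_k$; (iii) set $x_{k+1}=x_k+s_k$ and $\nu_{k+1}=\nu_k+\nu_k\|s_k\|^{p+1}$. Define $k_1=\inf\{k\ge1:\nu_k\ge 2L_p/\vartheta\}$ and let $\mathcal K_1$ be the event that $k_1<\infty$. *)

theory Defs
  imports "HOL-Analysis.Analysis"
begin

text \<open>Symmetric i-tensors on R^n are represented as multilinear forms
  T :: (nat => real^'n) => real, applied to the argument vectors vs 0, ..., vs (i-1).
  T[d]^i is T (\<lambda>_. d).\<close>

text \<open>Induced (subordinate) norm of an i-tensor.\<close>
definition tnorm :: "nat \<Rightarrow> ((nat \<Rightarrow> real^'n) \<Rightarrow> real) \<Rightarrow> real" where
  "tnorm i T = (SUP vs \<in> {vs. \<forall>j<i. norm (vs j) \<le> 1}. \<bar>T vs\<bar>)"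

text \<open>D is the tower of derivatives of f up to order p: D 0 x = f x, and
  D (i+1) x is the Frechet derivative of D i (in the new slot i), for i < p.
  Such a tower is unique if it exists.\<close>
definition deriv_tower :: "nat \<Rightarrow> (real^'n \<Rightarrow> real) \<Rightarrow>
    (nat \<Rightarrow> real^'n \<Rightarrow> (nat \<Rightarrow> real^'n) \<Rightarrow> real) \<Rightarrow> bool" where
  "deriv_tower p f D \<longleftrightarrow>
     (\<forall>x vs. D 0 x vs = f x) \<and>
     (\<forall>i<p. \<forall>x vs. ((\<lambda>y. D i y vs) has_derivative (\<lambda>h. D (Suc i) x (vs(i := h)))) (at x))"

text \<open>AS.1: f is p times continuously differentiable, with derivative tensors D.\<close>
definition AS1 :: "nat \<Rightarrow> (real^'n \<Rightarrow> real) \<Rightarrow>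
    (nat \<Rightarrow> real^'n \<Rightarrow> (nat \<Rightarrow> real^'n) \<Rightarrow> real) \<Rightarrow> bool" where
  "AS1 p f D \<longleftrightarrow> deriv_tower p f D \<and>
     (\<forall>x. ((\<lambda>y. tnorm p (\<lambda>vs. D p y vs - D p x vs)) \<longlongrightarrow> 0) (at x))"

text \<open>Gradient (library notion GDERIV).\<close>
definition grad :: "('a::real_inner \<Rightarrow> real) \<Rightarrow> 'a \<Rightarrow> 'a" where
  "grad h y = (THE G. GDERIV h y :> G)"

text \<open>Taylor polynomial T_{f,p}(x,s).\<close>
definition taylor :: "nat \<Rightarrow> (real^'n \<Rightarrow> real) \<Rightarrow>
    (nat \<Rightarrow> real^'n \<Rightarrow> (nat \<Rightarrow> real^'n) \<Rightarrow> real) \<Rightarrow> real^'n \<Rightarrow> real^'n \<Rightarrow> real" where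
  "taylor p f D x s = f x + (\<Sum>i=1..p. D i x (\<lambda>_. s) / fact i)"

text \<open>Sketched Taylor model  hatT_k(sh) = T_{f,p}(x_k, S_k^T sh).\<close>
definition sk_taylor :: "nat \<Rightarrow> (real^'n \<Rightarrow> real) \<Rightarrow>
    (nat \<Rightarrow> real^'n \<Rightarrow> (nat \<Rightarrow> real^'n) \<Rightarrow> real) \<Rightarrow> real^'n \<Rightarrow> real^'n^'l \<Rightarrow> real^'l \<Rightarrow> real" where
  "sk_taylor p f D x S sh = taylor p f D x (transpose S *v sh)"

text \<open>Sketched regularized model hatm_k.\<close>
definition sk_model :: "nat \<Rightarrow> (real^'n \<Rightarrow> real) \<Rightarrow>
    (nat \<Rightarrow> real^'n \<Rightarrow> (nat \<Rightarrow> real^'n) \<Rightarrow> real) \<Rightarrow> real^'n \<Rightarrow> real^'n^'l \<Rightarrow> real \<Rightarrow> real^'l \<Rightarrow> real" where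
  "sk_model p f D x S \<sigma> sh = sk_taylor p f D x S sh + \<sigma> / fact (p+1) * norm (transpose S *v sh) ^ (p+1)"

text \<open>A realization of SKOFFARp.  mu 0 plays the role of mu_{-1} (mu_0 = mu_{-1},
  no update at k = 0), mu k for k >= 1 is mu_k.\<close>
definition skoffar_run :: "nat \<Rightarrow> (real^'n \<Rightarrow> real) \<Rightarrow>
    (nat \<Rightarrow> real^'n \<Rightarrow> (nat \<Rightarrow> real^'n) \<Rightarrow> real) \<Rightarrow> real \<Rightarrow> real \<Rightarrow> real \<Rightarrow> real \<Rightarrow>
    (nat \<Rightarrow> real^'n) \<Rightarrow> (nat \<Rightarrow> real) \<Rightarrow> (nat \<Rightarrow> real) \<Rightarrow> (nat \<Rightarrow> real) \<Rightarrow> (nat \<Rightarrow> real) \<Rightarrow>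
    (nat \<Rightarrow> real^'n^'l) \<Rightarrow> (nat \<Rightarrow> real^'l) \<Rightarrow> bool" where
  "skoffar_run p f D \<nu>0 \<epsilon> \<theta> vth x \<sigma> \<nu> \<mu> \<kappa>S S sh \<longleftrightarrow>
     \<nu>0 > 0 \<and> 0 < \<epsilon> \<and> \<epsilon> \<le> 1 \<and> \<theta> > 1 \<and> 0 < vth \<and> vth < 1 \<and> \<mu> 0 \<ge> 0 \<and>
     \<nu> 0 = \<nu>0 \<and> \<sigma> 0 = \<nu>0 \<and>
     (\<forall>k\<ge>1. \<kappa>S (k-1) \<ge> onorm ((*v) (S (k-1))) \<and>
        \<mu> k = max (\<mu> (k-1))
          ((norm (S (k-1) *v grad f (x k)) - norm (grad (sk_taylor p f D (x (k-1)) (S (k-1))) (sh (k-1))))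
            / (\<kappa>S (k-1) * norm (transpose (S (k-1)) *v sh (k-1)) ^ p)) \<and>
        vth * \<nu> k \<le> \<sigma> k \<and> \<sigma> k \<le> max (\<nu> k) (\<mu> k)) \<and>
     (\<forall>k. sk_model p f D (x k) (S k) (\<sigma> k) (sh k) < sk_model p f D (x k) (S k) (\<sigma> k) 0 \<and>
        norm (grad (sk_taylor p f D (x k) (S k)) (sh k))
          \<le> \<theta> * \<sigma> k / fact p * norm (transpose (S k) *v sh k) ^ (p-1)
              * norm (S k *v (transpose (S k) *v sh k)) \<and>
        x (Suc k) = x k + transpose (S k) *v sh k \<and>
        \<nu> (Suc k) = \<nu> k + \<nu> k * norm (transpose (S k) *v sh k) ^ (p+1))"

end

(* Since the sketched model decreases along each step, the Taylor remainder bound coming from the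
   Lipschitz p-th derivative gives f(x_{k+1}) <= f(x_k) + (L_p - sigma_k) |s_k|^(p+1) / (p+1)!,
   while the lower bounds on the derivatives of orders 1..p turn the same model decrease into a
   polynomial inequality bounding |s_k| uniformly.  As nu_{k+1} - nu_k = nu_k |s_k|^(p+1) >=
   nu_0 |s_k|^(p+1), the total increase of f up to k_1 is at most L_p (nu_{k_1} - nu_0) / (nu_0 (p+1)!),
   and nu_{k_1} <= nu_max because nu_{k_1 - 1} is still below the threshold 2 L_p / vartheta and the
   last step is bounded.  When k_1 = 1 one uses sigma_0 = nu_0 instead. *)

theory Submission
  imports Defs
begin

definition multilinear_form :: "nat \<Rightarrow> ((nat \<Rightarrow> 'a::real_vector) \<Rightarrow> real) \<Rightarrow> bool" where
  "multilinear_form m T \<longleftrightarrow>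
     (\<forall>vs vs'. (\<forall>j<m. vs j = vs' j) \<longrightarrow> T vs = T vs') \<and>
     (\<forall>j<m. \<forall>vs. linear (\<lambda>h. T (vs(j := h))))"

lemma multilinear_form_cong:
  "multilinear_form m T \<Longrightarrow> (\<And>j. j < m \<Longrightarrow> vs j = vs' j) \<Longrightarrow> T vs = T vs'"
  unfolding multilinear_form_def by blast

lemma multilinear_form_linear:
  "multilinear_form m T \<Longrightarrow> j < m \<Longrightarrow> linear (\<lambda>h. T (vs(j := h)))"
  unfolding multilinear_form_def by blast

text \<open>Linear relations between slices of level i pass to level i+1 by uniqueness of the
  derivative; this is what makes every level of the tower multilinear.\<close>
lemma deriv_tower_Suc_relation:
  assumes DT: "deriv_tower p f D" and i: "i < p"
    and rel: "\<And>z. D i z vs = a * D i z us + b * D i z ws"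
  shows "D (Suc i) y (vs(i := h)) = a * D (Suc i) y (us(i := h)) + b * D (Suc i) y (ws(i := h))"
proof -
  have der: "((\<lambda>z. D i z ws) has_derivative (\<lambda>h. D (Suc i) y (ws(i := h)))) (at y)" for ws
    using DT i by (simp add: deriv_tower_def)
  have "((\<lambda>z. D i z vs) has_derivative
      (\<lambda>h. a * D (Suc i) y (us(i := h)) + b * D (Suc i) y (ws(i := h)))) (at y)"
    unfolding rel by (intro has_derivative_add has_derivative_mult_right der)
  from has_derivative_unique[OF der this] show ?thesis by (rule fun_cong)
qed

lemma deriv_tower_multilinear:
  assumes DT: "deriv_tower p f D"
  shows "i \<le> p \<Longrightarrow> multilinear_form i (D i y)"
proof (induction i arbitrary: y)
  case 0
  then show ?case using DT by (simp add: multilinear_form_def deriv_tower_def)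
next
  case (Suc i)
  have ip: "i < p" using Suc.prems by simp
  note IH = Suc.IH[OF less_imp_le[OF ip]]
  note rel = deriv_tower_Suc_relation[OF DT ip]
  have reset: "\<And>a. vs(j := a, i := vs i) = vs(j := a)" if "j \<noteq> i" for vs :: "nat \<Rightarrow> real^'a" and j
    using that by (auto simp: fun_eq_iff)
  have cong: "D (Suc i) y vs = D (Suc i) y vs'" if "\<forall>j<Suc i. vs j = vs' j" for vs vs'
  proof -
    have "D i z vs = D i z vs'" for z
      by (rule multilinear_form_cong[OF IH]) (use that in auto)
    then have "D i z vs = 1 * D i z vs' + 0 * D i z vs'" for z
      by simp
    from rel[OF this, of y "vs i"] have "D (Suc i) y (vs(i := vs i)) = D (Suc i) y (vs'(i := vs i))"
      by simp
    moreover have "vs'(i := vs i) = vs'" using that by auto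
    ultimately show ?thesis by simp
  qed
  have linear_slot: "linear (\<lambda>h. D (Suc i) y (vs(j := h)))" if "j < Suc i" for j vs
  proof (cases "j = i")
    case True
    then show ?thesis using DT ip has_derivative_linear by (fastforce simp: deriv_tower_def)
  next
    case False
    hence ji: "j < i" using that by simp
    have lin: "linear (\<lambda>h. D i z (vs(j := h)))" for z
      by (rule multilinear_form_linear[OF IH ji])
    show ?thesis
    proof (rule linearI)
      fix u w
      have "D i z (vs(j := u + w)) = 1 * D i z (vs(j := u)) + 1 * D i z (vs(j := w))" for z
        using linear_add[OF lin, of z u w] by (simp del: fun_upd_apply)
      from rel[OF this, of y "vs i"]
      show "D (Suc i) y (vs(j := u + w)) = D (Suc i) y (vs(j := u)) + D (Suc i) y (vs(j := w))"
        using reset[OF False] by simp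
    next
      fix c u
      have "D i z (vs(j := c *\<^sub>R u)) = c * D i z (vs(j := u)) + 0 * D i z (vs(j := u))" for z
        using linear_scale[OF lin, of z c u] by (simp del: fun_upd_apply)
      from rel[OF this, of y "vs i"]
      show "D (Suc i) y (vs(j := c *\<^sub>R u)) = c *\<^sub>R D (Suc i) y (vs(j := u))"
        using reset[OF False] by simp
    qed
  qed
  show ?case unfolding multilinear_form_def using cong linear_slot by blast
qed

lemma multilinear_form_homogeneous:
  assumes T: "multilinear_form m T"
  shows "T (\<lambda>_. c *\<^sub>R u) = c ^ m * T (\<lambda>_. u)"
proof -
  have scaled_prefix: "T (\<lambda>j. if j < k then c *\<^sub>R u else u) = c ^ k * T (\<lambda>_. u)" if "k \<le> m" for k
    using that
  proof (induction k)
    case 0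
    then show ?case by simp
  next
    case (Suc k)
    let ?v = "\<lambda>j. if j < k then c *\<^sub>R u else u"
    have "(\<lambda>j. if j < Suc k then c *\<^sub>R u else u) = ?v(k := c *\<^sub>R u)" and "?v(k := u) = ?v"
      by (auto simp: fun_eq_iff less_Suc_eq)
    moreover have "T (?v(k := c *\<^sub>R u)) = c * T (?v(k := u))"
      using linear_scale[OF multilinear_form_linear[OF T], of k ?v c u] Suc.prems by simp
    ultimately show ?case using Suc by simp
  qed
  have "T (\<lambda>_. c *\<^sub>R u) = T (\<lambda>j. if j < m then c *\<^sub>R u else u)"
    by (rule multilinear_form_cong[OF T]) simp
  with scaled_prefix[of m] show ?thesis by simp
qed

lemma multilinear_form_zero:
  assumes "multilinear_form m T" "m \<ge> 1"
  shows "T (\<lambda>_. 0) = 0"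
  using multilinear_form_homogeneous[OF assms(1), of 0 0] assms(2) by (simp add: power_0_left)

lemma multilinear_form_fix_last:
  assumes "multilinear_form (Suc m) T"
  shows "multilinear_form m (\<lambda>vs. T (vs(m := b)))"
  unfolding multilinear_form_def
proof safe
  fix vs vs' :: "nat \<Rightarrow> 'a"
  assume "\<forall>j<m. vs j = vs' j"
  then show "T (vs(m := b)) = T (vs'(m := b))"
    by (intro multilinear_form_cong[OF assms]) (auto simp: less_Suc_eq)
next
  fix j vs
  assume j: "j < m"
  have "(\<lambda>h. T (vs(j := h, m := b))) = (\<lambda>h. T ((vs(m := b))(j := h)))"
    using j by (simp add: fun_upd_twist)
  with multilinear_form_linear[OF assms, of j "vs(m := b)"] j
  show "linear (\<lambda>h. T (vs(j := h, m := b)))" by simp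
qed

lemma multilinear_form_bounded:
  fixes T :: "(nat \<Rightarrow> 'a::euclidean_space) \<Rightarrow> real"
  assumes "multilinear_form m T"
  shows "\<exists>C. \<forall>vs. (\<forall>j<m. norm (vs j) \<le> 1) \<longrightarrow> \<bar>T vs\<bar> \<le> C"
  using assms
proof (induction m arbitrary: T)
  case 0
  have "T vs = T (\<lambda>_. 0)" for vs by (rule multilinear_form_cong[OF 0]) simp
  then show ?case by (metis order_refl)
next
  case (Suc m)
  have "\<forall>b\<in>Basis. \<exists>C. \<forall>vs. (\<forall>j<m. norm (vs j) \<le> 1) \<longrightarrow> \<bar>T (vs(m := b))\<bar> \<le> C"
    using Suc.IH[OF multilinear_form_fix_last[OF Suc.prems]] by blast
  then obtain C where C: "\<And>b vs. b \<in> Basis \<Longrightarrow> \<forall>j<m. norm (vs j) \<le> 1 \<Longrightarrow> \<bar>T (vs(m := b))\<bar> \<le> C b"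
    by metis
  show ?case
  proof (intro exI allI impI)
    fix vs :: "nat \<Rightarrow> 'a"
    assume unit: "\<forall>j<Suc m. norm (vs j) \<le> 1"
    have lin: "linear (\<lambda>h. T (vs(m := h)))" by (rule multilinear_form_linear[OF Suc.prems]) simp
    have "T vs = T (vs(m := \<Sum>b\<in>Basis. (vs m \<bullet> b) *\<^sub>R b))"
      by (simp add: euclidean_representation)
    also have "\<dots> = (\<Sum>b\<in>Basis. (vs m \<bullet> b) * T (vs(m := b)))"
      by (simp add: linear_sum[OF lin] linear_scale[OF lin])
    finally have "\<bar>T vs\<bar> \<le> (\<Sum>b\<in>Basis. \<bar>vs m \<bullet> b\<bar> * \<bar>T (vs(m := b))\<bar>)"
      by (simp add: sum_abs[THEN order_trans] abs_mult)
    also have "\<dots> \<le> (\<Sum>b\<in>Basis. 1 * C b)"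
    proof (rule sum_mono, rule mult_mono)
      fix b :: 'a
      assume b: "b \<in> Basis"
      show "\<bar>vs m \<bullet> b\<bar> \<le> 1" using Basis_le_norm[OF b, of "vs m"] unit by auto
      show "\<bar>T (vs(m := b))\<bar> \<le> C b" using C[OF b] unit by auto
    qed simp_all
    finally show "\<bar>T vs\<bar> \<le> (\<Sum>b\<in>Basis. C b)" by simp
  qed
qed

lemma multilinear_form_le_tnorm:
  fixes T :: "(nat \<Rightarrow> real^'n) \<Rightarrow> real"
  assumes T: "multilinear_form m T"
  shows "\<bar>T (\<lambda>_. s)\<bar> \<le> tnorm m T * norm s ^ m"
proof -
  obtain C where C: "\<And>vs. \<forall>j<m. norm (vs j) \<le> 1 \<Longrightarrow> \<bar>T vs\<bar> \<le> C"
    using multilinear_form_bounded[OF T] by blast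
  have unit: "\<bar>T (\<lambda>_. u)\<bar> \<le> tnorm m T" if "norm u \<le> 1" for u :: "real^'n"
    unfolding tnorm_def by (rule cSUP_upper) (use that C in \<open>auto intro!: bdd_aboveI2\<close>)
  show ?thesis
  proof (cases "s = 0")
    case True
    then show ?thesis
      using unit[of 0] multilinear_form_zero[OF T] by (cases m) auto
  next
    case False
    let ?u = "(1 / norm s) *\<^sub>R s"
    have "T (\<lambda>_. s) = T (\<lambda>_. norm s *\<^sub>R ?u)" using False by simp
    also have "\<dots> = norm s ^ m * T (\<lambda>_. ?u)" by (rule multilinear_form_homogeneous[OF T])
    finally have "\<bar>T (\<lambda>_. s)\<bar> = norm s ^ m * \<bar>T (\<lambda>_. ?u)\<bar>" by (simp add: abs_mult)
    also have "\<dots> \<le> norm s ^ m * tnorm m T"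
      by (rule mult_left_mono) (use unit[of ?u] False in auto)
    finally show ?thesis by (simp add: mult.commute)
  qed
qed

lemma multilinear_form_diff:
  assumes "multilinear_form m T" "multilinear_form m U"
  shows "multilinear_form m (\<lambda>vs. T vs - U vs)"
  using assms unfolding multilinear_form_def by (auto intro!: linear_compose_sub) metis

lemma multilinear_form_ge_on_unit_ball:
  assumes T: "multilinear_form m T" and m: "m \<ge> 1"
    and lower: "\<And>d. norm d \<le> 1 \<Longrightarrow> T (\<lambda>_. d) \<ge> - c"
  shows "T (\<lambda>_. s) \<ge> - c * norm s ^ m"
proof (cases "s = 0")
  case True
  then show ?thesis using multilinear_form_zero[OF T m] m by (simp add: power_0_left)
next
  case False
  let ?u = "(1 / norm s) *\<^sub>R s"
  have "T (\<lambda>_. s) = norm s ^ m * T (\<lambda>_. ?u)"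
    using multilinear_form_homogeneous[OF T, of "norm s" ?u] False by simp
  moreover have "norm s ^ m * (- c) \<le> norm s ^ m * T (\<lambda>_. ?u)"
    by (rule mult_left_mono) (use lower[of ?u] False in auto)
  ultimately show ?thesis by (simp add: mult.commute)
qed

lemma DERIV_sum_power_divide_fact:
  fixes c :: "nat \<Rightarrow> real"
  shows "DERIV (\<lambda>t. \<Sum>j\<le>n. c j * t ^ j / fact j) t :> (\<Sum>j<n. c (Suc j) * t ^ j / fact j)"
proof (induction n)
  case 0
  then show ?case by simp
next
  case (Suc n)
  have "DERIV (\<lambda>t. c (Suc n) * t ^ Suc n / fact (Suc n)) t :> c (Suc n) * (real (Suc n) * t ^ n) / fact (Suc n)"
    by (intro DERIV_cdivide DERIV_cmult) (use DERIV_pow[of "Suc n" t] in simp)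
  moreover have "c (Suc n) * (real (Suc n) * t ^ n) / fact (Suc n) = c (Suc n) * t ^ n / fact n"
    by (simp add: field_simps del: of_nat_Suc)
  ultimately have "DERIV (\<lambda>t. c (Suc n) * t ^ Suc n / fact (Suc n)) t :> c (Suc n) * t ^ n / fact n"
    by simp
  from DERIV_add[OF Suc this] show ?case by (simp add: add.commute)
qed

lemma Taylor_nonpos:
  fixes \<psi> :: "nat \<Rightarrow> real \<Rightarrow> real"
  assumes n: "n > 0"
    and deriv: "\<forall>m t. m < n \<and> 0 \<le> t \<and> t \<le> 1 \<longrightarrow> DERIV (\<psi> m) t :> \<psi> (Suc m) t"
    and zero: "\<And>m. m < n \<Longrightarrow> \<psi> m 0 = 0"
    and nonpos: "\<And>t. 0 < t \<Longrightarrow> t < 1 \<Longrightarrow> \<psi> n t \<le> 0"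
  shows "\<psi> 0 1 \<le> 0"
proof -
  obtain t where t: "0 < t" "t < 1" and "\<psi> 0 1 = (\<Sum>m<n. \<psi> m 0 / fact m * (1 - 0) ^ m) + \<psi> n t / fact n * (1 - 0) ^ n"
    using Taylor_up[OF n refl deriv order_refl zero_less_one] by auto
  then have "\<psi> 0 1 = \<psi> n t / fact n" using zero by simp
  with nonpos[OF t] show ?thesis by (simp add: divide_nonpos_pos)
qed

lemma deriv_tower_DERIV_line:
  assumes DT: "deriv_tower p f D" and m: "m < p"
  shows "DERIV (\<lambda>t. D m (x + t *\<^sub>R s) (\<lambda>_. s)) t :> D (Suc m) (x + t *\<^sub>R s) (\<lambda>_. s)"
proof -
  let ?y = "x + t *\<^sub>R s"
  let ?L = "\<lambda>h. D (Suc m) ?y ((\<lambda>_. s)(m := h))"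
  have der: "((\<lambda>z. D m z (\<lambda>_. s)) has_derivative ?L) (at ?y)"
    using DT m by (simp add: deriv_tower_def)
  have "((\<lambda>t. x + t *\<^sub>R s) has_derivative (\<lambda>\<tau>. \<tau> *\<^sub>R s)) (at t)"
    by (auto intro!: derivative_eq_intros)
  from has_derivative_compose[OF this der]
  have "((\<lambda>t. D m (x + t *\<^sub>R s) (\<lambda>_. s)) has_derivative (\<lambda>\<tau>. ?L (\<tau> *\<^sub>R s))) (at t)" .
  moreover have "?L (\<tau> *\<^sub>R s) = D (Suc m) ?y (\<lambda>_. s) * \<tau>" for \<tau>
    using linear_scale[OF has_derivative_linear[OF der], of \<tau> s] by (simp add: fun_upd_def mult.commute)
  ultimately show ?thesis unfolding has_field_derivative_def by simp
qed

lemma deriv_tower_taylor_eq: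
  assumes "deriv_tower p f D"
  shows "taylor p f D x s = (\<Sum>j\<le>p. D j x (\<lambda>_. s) / fact j)"
  using assms unfolding taylor_def by (simp add: deriv_tower_def atMost_atLeast0 sum.atLeast_Suc_atMost)

lemma deriv_tower_taylor_zero:
  assumes DT: "deriv_tower p f D"
  shows "taylor p f D x 0 = f x"
  unfolding taylor_def
  using multilinear_form_zero[OF deriv_tower_multilinear[OF DT]] by simp

text \<open>Along t \<mapsto> x + t s, compare f with the Taylor polynomial extended by the term
  L_p |s|^(p+1) t^(p+1) / (p+1)!: the difference \<psi> 0 and its derivatives up to order p-1 vanish
  at t = 0, and its p-th derivative is nonpositive by the Lipschitz bound on the p-th derivative.\<close>
lemma taylor_upper_bound:
  assumes DT: "deriv_tower p f D" and p: "p \<ge> 1"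
    and Lipschitz: "\<And>y z. tnorm p (\<lambda>vs. D p y vs - D p z vs) \<le> Lp * norm (y - z)"
  shows "f (x + s) \<le> taylor p f D x s + Lp * norm s ^ (p+1) / fact (p+1)"
proof -
  define a where "a j = (if j \<le> p then D j x (\<lambda>_. s) else Lp * norm s ^ (p+1))" for j
  define P where "P m t = (\<Sum>j\<le>p+1-m. a (j+m) * t ^ j / fact j)" for m t
  define \<psi> where "\<psi> m t = D m (x + t *\<^sub>R s) (\<lambda>_. s) - P m t" for m t
  have "DERIV (P m) t :> P (Suc m) t" if "m < p" for m t
  proof -
    have "{..<p+1-m} = {..p+1 - Suc m}" using that by auto
    with DERIV_sum_power_divide_fact[of "\<lambda>j. a (j + m)" "p+1-m" t] show ?thesis
      unfolding P_def by simp
  qed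
  then have deriv: "\<forall>m t. m < p \<and> 0 \<le> t \<and> t \<le> 1 \<longrightarrow> DERIV (\<psi> m) t :> \<psi> (Suc m) t"
    unfolding \<psi>_def[abs_def] by (auto intro!: DERIV_diff deriv_tower_DERIV_line[OF DT])
  have "P m 0 = a m" for m
    unfolding P_def by (simp add: atMost_atLeast0 sum.atLeast_Suc_atMost)
  then have zero: "\<psi> m 0 = 0" if "m < p" for m
    using that unfolding \<psi>_def a_def by simp
  have nonpos: "\<psi> p t \<le> 0" if "0 < t" "t < 1" for t
  proof -
    let ?y = "x + t *\<^sub>R s"
    have "multilinear_form p (\<lambda>vs. D p ?y vs - D p x vs)"
      by (intro multilinear_form_diff deriv_tower_multilinear[OF DT]) simp_all
    from multilinear_form_le_tnorm[OF this, of s]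
    have "D p ?y (\<lambda>_. s) - D p x (\<lambda>_. s) \<le> tnorm p (\<lambda>vs. D p ?y vs - D p x vs) * norm s ^ p"
      by simp
    also have "\<dots> \<le> Lp * norm (?y - x) * norm s ^ p"
      by (intro mult_right_mono Lipschitz) simp
    also have "\<dots> = Lp * norm s ^ (p+1) * t" using that by simp
    finally show ?thesis unfolding \<psi>_def P_def a_def by simp
  qed
  have "\<psi> 0 1 \<le> 0" by (rule Taylor_nonpos[OF _ deriv zero nonpos]) (use p in auto)
  moreover have "P 0 1 = taylor p f D x s + Lp * norm s ^ (p+1) / fact (p+1)"
    unfolding P_def a_def deriv_tower_taylor_eq[OF DT] by simp
  ultimately show ?thesis using DT unfolding \<psi>_def by (simp add: deriv_tower_def)
qed

lemma has_derivative_eq_inner_grad: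
  fixes f :: "'a::euclidean_space \<Rightarrow> real"
  assumes der: "(f has_derivative L) (at x)"
  shows "L h = h \<bullet> grad f x"
proof -
  have lin: "linear L" by (rule has_derivative_linear[OF der])
  define G where "G = adjoint L 1"
  have LG: "L h = h \<bullet> G" for h
    using adjoint_works[OF lin, of h 1] unfolding G_def by simp
  have "L = (\<lambda>h. h \<bullet> G)" using LG by (simp add: fun_eq_iff)
  with der have gd: "GDERIV f x :> G" by (simp add: gderiv_def)
  have "grad f x = G" unfolding grad_def
  proof (rule the_equality)
    fix G' assume "GDERIV f x :> G'"
    then have "(\<lambda>h. h \<bullet> G') = (\<lambda>h. h \<bullet> G)"
      using has_derivative_unique gd unfolding gderiv_def by blast
    then show "G' = G" by (metis vector_eq_ldot)
  qed (rule gd)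
  with LG show ?thesis by simp
qed

lemma deriv_tower_first_eq_inner_grad:
  assumes DT: "deriv_tower p f D" and p: "p \<ge> 1"
  shows "D 1 x (\<lambda>_. s) = s \<bullet> grad f x"
proof -
  have "(\<lambda>z. D 0 z (\<lambda>_. s)) = f" using DT by (simp add: deriv_tower_def fun_eq_iff)
  moreover have "((\<lambda>z. D 0 z (\<lambda>_. s)) has_derivative (\<lambda>h. D 1 x ((\<lambda>_. s)(0 := h)))) (at x)"
    using conjunct2[OF DT[unfolded deriv_tower_def]] p by simp
  ultimately have "(f has_derivative (\<lambda>h. D 1 x ((\<lambda>_. s)(0 := h)))) (at x)"
    by simp
  from has_derivative_eq_inner_grad[OF this, of s]
  have "D 1 x ((\<lambda>_. s)(0 := s)) = s \<bullet> grad f x" .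
  then show ?thesis by (simp add: fun_upd_def)
qed

lemma sum_half_powers:
  assumes "p \<ge> 1"
  shows "(\<Sum>i=2..p. (1/2::real) ^ (p - i + 1)) = 1 - (1/2) ^ (p - 1)"
  using assms
proof (induction p rule: dec_induct)
  case base
  then show ?case by simp
next
  case (step p)
  have "(\<Sum>i=2..Suc p. (1/2::real) ^ (Suc p - i + 1)) = (\<Sum>i=2..p. (1/2) * (1/2::real) ^ (p - i + 1)) + 1/2"
    using step.hyps by (simp add: sum.cl_ivl_Suc Suc_diff_le)
  also have "\<dots> = (1/2) * (1 - (1/2) ^ (p - 1)) + 1/2"
    by (simp only: sum_distrib_left[symmetric] step.IH)
  finally show ?case using step.hyps by (cases p) auto
qed

lemma powr_inverse_power:
  fixes c :: real
  assumes "c \<ge> 0" "k \<ge> 1"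
  shows "(c powr (1 / real k)) ^ k = c"
  using assms by (simp add: powr_realpow'[symmetric] powr_powr)

text \<open>If t exceeded the bound, then A < (t/2)^p and every c i t^(i-1) < (t/2)^(p-i+1) t^(i-1), and
  these fractions of t^p add up to less than t^p.\<close>
lemma power_le_poly_imp_le:
  fixes t A :: real and c :: "nat \<Rightarrow> real"
  assumes p: "p \<ge> 1" and t: "t \<ge> 0" and A: "A \<ge> 0" and c: "\<And>i. i \<in> {2..p} \<Longrightarrow> c i \<ge> 0"
    and ineq: "t ^ p \<le> A + (\<Sum>i=2..p. c i * t ^ (i - 1))"
  shows "t \<le> 2 * (\<Sum>i=2..p. c i powr (1 / real (p - i + 1))) + 2 * A powr (1 / real p)"
proof (rule ccontr)
  let ?\<eta> = "\<Sum>i=2..p. c i powr (1 / real (p - i + 1))"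
  assume "\<not> ?thesis"
  then have lt: "2 * ?\<eta> + 2 * A powr (1 / real p) < t" by simp
  have \<eta>: "?\<eta> \<ge> 0" by (intro sum_nonneg) simp
  have coeff: "c i * t ^ (i - 1) \<le> t ^ p * (1/2) ^ (p - i + 1)" if i: "i \<in> {2..p}" for i
  proof -
    let ?k = "p - i + 1"
    have "c i powr (1 / real ?k) \<le> ?\<eta>" by (rule member_le_sum[OF i]) auto
    then have "c i powr (1 / real ?k) \<le> t / 2" using lt powr_ge_zero[of A "1 / real p"] by linarith
    then have "(c i powr (1 / real ?k)) ^ ?k \<le> (t / 2) ^ ?k" by (rule power_mono) simp
    then have "c i \<le> (t / 2) ^ ?k" using powr_inverse_power[of "c i" ?k] c[OF i] by simp
    then have "c i * t ^ (i - 1) \<le> (t / 2) ^ ?k * t ^ (i - 1)" by (rule mult_right_mono) (use t in simp)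
    also have "\<dots> = t ^ (?k + (i - 1)) * (1/2) ^ ?k" by (simp add: power_add power_divide field_simps)
    also have "?k + (i - 1) = p" using i by auto
    finally show ?thesis .
  qed
  have "A powr (1 / real p) < t / 2" using lt \<eta> by linarith
  then have "(A powr (1 / real p)) ^ p < (t / 2) ^ p" by (rule power_strict_mono) (use p in auto)
  then have "A < t ^ p * (1/2) ^ p" using powr_inverse_power[OF A p] by (simp add: power_divide)
  moreover have "(\<Sum>i=2..p. c i * t ^ (i - 1)) \<le> (\<Sum>i=2..p. t ^ p * (1/2) ^ (p - i + 1))"
    by (rule sum_mono) (rule coeff)
  ultimately have "t ^ p < t ^ p * (1/2) ^ p + (\<Sum>i=2..p. t ^ p * (1/2) ^ (p - i + 1))"
    using ineq by linarith
  also have "\<dots> = t ^ p * ((1/2) ^ p + (\<Sum>i=2..p. (1/2) ^ (p - i + 1)))"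
    by (simp only: sum_distrib_left distrib_left)
  also have "\<dots> = t ^ p * ((1/2) ^ p + (1 - (1/2) ^ (p - 1)))"
    by (simp only: sum_half_powers[OF p])
  also have "\<dots> \<le> t ^ p"
    using power_decreasing[of "p - 1" p "1/2::real"] t by (simp add: mult_left_le)
  finally show False by simp
qed

lemma taylor_lower_bound:
  assumes DT: "deriv_tower p f D" and p: "p \<ge> 1"
    and grad: "norm (grad f x) \<le> \<kappa>g"
    and high: "\<forall>i\<in>{2..p}. \<forall>d. norm d \<le> 1 \<longrightarrow> D i x (\<lambda>_. d) \<ge> - \<kappa>high"
  shows "f x - \<kappa>g * norm s - (\<Sum>i=2..p. \<kappa>high * norm s ^ i / fact i) \<le> taylor p f D x s"
proof -
  have "- \<kappa>g * norm s \<le> s \<bullet> grad f x"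
    using norm_cauchy_schwarz[of "- s" "grad f x"] mult_left_mono[OF grad, of "norm s"]
    by (simp add: mult.commute)
  then have first: "- \<kappa>g * norm s \<le> D 1 x (\<lambda>_. s)"
    unfolding deriv_tower_first_eq_inner_grad[OF DT p] .
  have "- (\<kappa>high * norm s ^ i / fact i) \<le> D i x (\<lambda>_. s) / fact i" if i: "i \<in> {2..p}" for i
  proof -
    have "- \<kappa>high * norm s ^ i \<le> D i x (\<lambda>_. s)"
      by (rule multilinear_form_ge_on_unit_ball[where T = "D i x"])
        (use i high deriv_tower_multilinear[OF DT] in auto)
    from divide_right_mono[OF this, of "fact i"] show ?thesis by simp
  qed
  then have "- (\<Sum>i=2..p. \<kappa>high * norm s ^ i / fact i) \<le> (\<Sum>i=2..p. D i x (\<lambda>_. s) / fact i)"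
    unfolding sum_negf[symmetric] by (rule sum_mono) simp
  moreover have "taylor p f D x s = f x + D 1 x (\<lambda>_. s) + (\<Sum>i=2..p. D i x (\<lambda>_. s) / fact i)"
    unfolding taylor_def using sum.atLeast_Suc_atMost[OF p, of "\<lambda>i. D i x (\<lambda>_. s) / fact i"]
    by (simp add: numeral_2_eq_2)
  ultimately show ?thesis using first by linarith
qed

lemma regularized_step_decrease:
  assumes DT: "deriv_tower p f D" and p: "p \<ge> 1"
    and Lipschitz: "\<And>y z. tnorm p (\<lambda>vs. D p y vs - D p z vs) \<le> Lp * norm (y - z)"
    and decrease: "taylor p f D x s + \<sigma> / fact (p+1) * norm s ^ (p+1) < f x"
  shows "f (x + s) \<le> f x + (Lp - \<sigma>) * norm s ^ (p+1) / fact (p+1)"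
  using taylor_upper_bound[OF DT p Lipschitz, of x s] decrease
  by (simp add: diff_divide_distrib left_diff_distrib)

text \<open>Dividing the model decrease by t = norm s leaves a polynomial inequality for t.\<close>
lemma regularized_step_norm_bound:
  assumes DT: "deriv_tower p f D" and p: "p \<ge> 1"
    and grad: "norm (grad f x) \<le> \<kappa>g"
    and high: "\<forall>i\<in>{2..p}. \<forall>d. norm d \<le> 1 \<longrightarrow> D i x (\<lambda>_. d) \<ge> - \<kappa>high"
    and \<kappa>high: "\<kappa>high \<ge> 0"
    and decrease: "taylor p f D x s + \<sigma> / fact (p+1) * norm s ^ (p+1) < f x"
    and \<sigma>: "\<sigma> \<ge> \<sigma>min" "\<sigma>min > 0"
  shows "norm s \<le> 2 * (\<Sum>i=2..p. (\<kappa>high * fact (p+1) / (fact i * \<sigma>min)) powr (1 / real (p - i + 1)))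
                    + 2 * (fact (p+1) * \<kappa>g / \<sigma>min) powr (1 / real p)"
proof -
  let ?F = "fact (p+1) :: real" and ?t = "norm s"
  define R where "R = \<kappa>g + (\<Sum>i=2..p. \<kappa>high * ?t ^ (i - 1) / fact i)"
  have \<kappa>g: "\<kappa>g \<ge> 0" using grad norm_ge_zero order_trans by blast
  have "?t * R = \<kappa>g * ?t + (\<Sum>i=2..p. \<kappa>high * ?t ^ i / fact i)"
    unfolding R_def distrib_left sum_distrib_left
    by (intro arg_cong2[where f = "(+)"] sum.cong) (auto simp: power_eq_if)
  with taylor_lower_bound[OF DT p grad high, of s] decrease
  have less: "?t * (\<sigma> / ?F * ?t ^ p) < ?t * R" by (simp add: ac_simps)
  then have "?t > 0" by (cases "?t = 0") auto
  with less have "\<sigma> / ?F * ?t ^ p < R" using mult_less_cancel_left_pos by blast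
  then have "\<sigma> * ?t ^ p < ?F * R" by (simp add: field_simps del: fact_Suc)
  then have "\<sigma>min * ?t ^ p < ?F * R"
    using mult_right_mono[OF \<sigma>(1) zero_le_power[OF norm_ge_zero, of s p]] by linarith
  then have "?t ^ p \<le> ?F * R / \<sigma>min" using \<sigma>(2) by (simp add: field_simps)
  also have "\<dots> = ?F * \<kappa>g / \<sigma>min + (\<Sum>i=2..p. \<kappa>high * ?F / (fact i * \<sigma>min) * ?t ^ (i - 1))"
    unfolding R_def by (simp add: distrib_left add_divide_distrib sum_distrib_left sum_divide_distrib ac_simps)
  finally have poly: "?t ^ p \<le> ?F * \<kappa>g / \<sigma>min
      + (\<Sum>i=2..p. \<kappa>high * ?F / (fact i * \<sigma>min) * ?t ^ (i - 1))" .
  show ?thesis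
    by (rule power_le_poly_imp_le[OF p norm_ge_zero _ _ poly]) (use \<kappa>g \<kappa>high \<sigma>(2) in auto)
qed

locale nu_growth =
  fixes \<nu> w :: "nat \<Rightarrow> real"
  assumes \<nu>0: "\<nu> 0 > 0" and w: "\<And>k. w k \<ge> 0"
    and \<nu>_Suc: "\<And>k. \<nu> (Suc k) = \<nu> k + \<nu> k * w k"
begin

lemma nu_ge: "\<nu> 0 \<le> \<nu> m"
proof (induction m)
  case (Suc m)
  have "\<nu> m * w m \<ge> 0" using Suc \<nu>0 w[of m] by simp
  then show ?case using Suc \<nu>_Suc[of m] by simp
qed simp

end

text \<open>Values \<phi> k along an iteration whose growth is controlled by that of \<nu>; w k plays the role
  of the norm of the k-th step to the power p+1 and F that of (p+1)!.\<close>
locale nu_controlled_descent = nu_growth \<nu> w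
  for \<phi> \<nu> \<sigma> w :: "nat \<Rightarrow> real" and Lp F :: real +
  assumes Lp: "Lp \<ge> 0" and F: "F > 0"
    and \<phi>_Suc: "\<And>k. \<phi> (Suc k) \<le> \<phi> k + (Lp - \<sigma> k) * w k / F"
begin

lemma phi_le_nu:
  assumes \<sigma>: "\<And>k. \<sigma> k \<ge> 0"
  shows "\<phi> m \<le> \<phi> 0 + Lp / \<nu> 0 * (\<nu> m - \<nu> 0) / F"
proof (induction m)
  case (Suc m)
  have "(Lp - \<sigma> m) * w m \<le> Lp / \<nu> 0 * (\<nu> 0 * w m)"
    using \<sigma>[of m] w[of m] \<nu>0 by (simp add: mult_right_mono)
  also have "\<dots> \<le> Lp / \<nu> 0 * (\<nu> m * w m)"
    by (intro mult_left_mono mult_right_mono nu_ge w) (use Lp \<nu>0 in simp)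
  also have "\<dots> = Lp / \<nu> 0 * (\<nu> (Suc m) - \<nu> m)" using \<nu>_Suc[of m] by simp
  finally have "(Lp - \<sigma> m) * w m / F \<le> Lp / \<nu> 0 * (\<nu> (Suc m) - \<nu> m) / F"
    using F by (intro divide_right_mono) auto
  moreover have "Lp / \<nu> 0 * (\<nu> (Suc m) - \<nu> 0) / F
      = Lp / \<nu> 0 * (\<nu> m - \<nu> 0) / F + Lp / \<nu> 0 * (\<nu> (Suc m) - \<nu> m) / F"
    by (simp add: diff_divide_distrib right_diff_distrib)
  ultimately show ?case using Suc \<phi>_Suc[of m] by linarith
qed simp

text \<open>At the first index k1 \<ge> 1 where \<nu> reaches \<tau>, either k1 \<ge> 2 and \<nu> k1 \<le> \<tau> (1 + W) because
  \<nu> (k1 - 1) < \<tau>, or k1 = 1, where \<sigma> 0 = \<nu> 0 is used directly.\<close>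
lemma phi_at_threshold:
  assumes \<sigma>: "\<And>k. \<sigma> k \<ge> 0" and \<sigma>0: "\<sigma> 0 = \<nu> 0" and W: "\<And>k. w k \<le> W" and \<tau>: "\<tau> \<ge> Lp"
    and k1: "k1 \<ge> 1" "\<And>k. 1 \<le> k \<Longrightarrow> k < k1 \<Longrightarrow> \<nu> k < \<tau>"
  shows "\<phi> k1 \<le> \<phi> 0 + Lp / \<nu> 0 * (\<tau> * (1 + W)) / F"
proof (cases "k1 = 1")
  case True
  have W0: "W \<ge> 0" using w[of 0] W[of 0] by linarith
  have "(Lp - \<nu> 0) * w 0 \<le> Lp / \<nu> 0 * (\<tau> * (1 + W))"
  proof (cases "Lp \<le> \<nu> 0")
    case True
    then show ?thesis
      using w[of 0] Lp \<nu>0 \<tau> W0 by (smt (verit) mult_nonneg_nonneg mult_nonpos_nonneg divide_nonneg_pos)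
  next
    case False
    have "(Lp - \<nu> 0) * w 0 \<le> Lp * W"
      using False \<nu>0 w[of 0] W[of 0] by (intro mult_mono) auto
    also have "\<dots> \<le> (Lp / \<nu> 0 * \<tau>) * (1 + W)"
    proof (rule mult_mono)
      show "Lp \<le> Lp / \<nu> 0 * \<tau>"
        using mult_mono[of 1 "Lp / \<nu> 0" Lp \<tau>] False \<nu>0 \<tau> Lp by simp
    qed (use Lp W0 \<nu>0 \<tau> in auto)
    finally show ?thesis by simp
  qed
  then have "(Lp - \<nu> 0) * w 0 / F \<le> Lp / \<nu> 0 * (\<tau> * (1 + W)) / F"
    using F by (intro divide_right_mono) auto
  then show ?thesis using \<phi>_Suc[of 0] \<sigma>0 True by simp
next
  case False
  then obtain j where j: "k1 = Suc j" "j \<ge> 1" using k1(1) by (cases k1) auto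
  have "\<nu> k1 = \<nu> j * (1 + w j)" using \<nu>_Suc[of j] j(1) by (simp add: distrib_left)
  also have "\<dots> \<le> \<tau> * (1 + W)"
    using k1(2)[of j] j nu_ge[of j] \<nu>0 w[of j] W[of j] by (intro mult_mono) auto
  finally have "Lp / \<nu> 0 * (\<nu> k1 - \<nu> 0) \<le> Lp / \<nu> 0 * (\<tau> * (1 + W))"
    using Lp \<nu>0 by (intro mult_left_mono) auto
  with phi_le_nu[OF \<sigma>, of k1] F show ?thesis by (smt (verit) divide_right_mono)
qed

end

lemma skoffar_run_nu_growth:
  assumes "skoffar_run p f D \<nu>0 \<epsilon> \<theta> vth x \<sigma> \<nu> \<mu> \<kappa>S S sh"
  shows "nu_growth \<nu> (\<lambda>k. norm (transpose (S k) *v sh k) ^ (p+1))"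
  using assms by unfold_locales (auto simp: skoffar_run_def)

lemma skoffar_run_sigma_lower:
  assumes run: "skoffar_run p f D \<nu>0 \<epsilon> \<theta> vth x \<sigma> \<nu> \<mu> \<kappa>S S sh"
  shows "\<sigma> k \<ge> vth * \<nu>0"
proof (cases "k = 0")
  case True
  with run show ?thesis by (simp add: skoffar_run_def)
next
  case False
  interpret nu_growth \<nu> "\<lambda>k. norm (transpose (S k) *v sh k) ^ (p+1)"
    by (rule skoffar_run_nu_growth[OF run])
  have "vth * \<nu>0 \<le> vth * \<nu> k"
    using run mult_left_mono[OF nu_ge[of k]] by (simp add: skoffar_run_def)
  also have "\<dots> \<le> \<sigma> k" using run False by (simp add: skoffar_run_def)
  finally show ?thesis .
qed

lemma skoffar_run_decrease:
  assumes DT: "deriv_tower p f D" and run: "skoffar_run p f D \<nu>0 \<epsilon> \<theta> vth x \<sigma> \<nu> \<mu> \<kappa>S S sh"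
  shows "taylor p f D (x k) (transpose (S k) *v sh k) + \<sigma> k / fact (p+1) * norm (transpose (S k) *v sh k) ^ (p+1)
    < f (x k)"
proof -
  have "sk_model p f D (x k) (S k) (\<sigma> k) (sh k) < sk_model p f D (x k) (S k) (\<sigma> k) 0"
    using run unfolding skoffar_run_def by blast
  then show ?thesis
    using deriv_tower_taylor_zero[OF DT, of "x k"] by (simp add: sk_model_def sk_taylor_def)
qed

lemma skoffar_run_descent:
  assumes DT: "deriv_tower p f D" and p: "p \<ge> 1" and Lp: "Lp \<ge> 0"
    and Lipschitz: "\<forall>y z. tnorm p (\<lambda>vs. D p y vs - D p z vs) \<le> Lp * norm (y - z)"
    and run: "skoffar_run p f D \<nu>0 \<epsilon> \<theta> vth x \<sigma> \<nu> \<mu> \<kappa>S S sh"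
  shows "nu_controlled_descent (\<lambda>k. f (x k)) \<nu> \<sigma> (\<lambda>k. norm (transpose (S k) *v sh k) ^ (p+1)) Lp (fact (p+1))"
proof (intro_locales)
  show "nu_growth \<nu> (\<lambda>k. norm (transpose (S k) *v sh k) ^ (p+1))"
    by (rule skoffar_run_nu_growth[OF run])
  show "nu_controlled_descent_axioms (\<lambda>k. f (x k)) \<sigma> (\<lambda>k. norm (transpose (S k) *v sh k) ^ (p+1)) Lp (fact (p+1))"
    using Lp run regularized_step_decrease[OF DT p _ skoffar_run_decrease[OF DT run]] Lipschitz
    by unfold_locales (auto simp: skoffar_run_def)
qed

theorem mainTheorem5:
  fixes f :: "real^'n \<Rightarrow> real"
    and D :: "nat \<Rightarrow> real^'n \<Rightarrow> (nat \<Rightarrow> real^'n) \<Rightarrow> real"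
    and S :: "nat \<Rightarrow> real^'n^'l"
    and sh :: "nat \<Rightarrow> real^'l"
    and x :: "nat \<Rightarrow> real^'n"
    and \<sigma> \<nu> \<mu> \<kappa>S :: "nat \<Rightarrow> real"
    and p :: nat and Lp \<kappa>g \<kappa>high \<nu>0 \<epsilon> \<theta> vth :: real
  assumes p1: "p \<ge> 1"
    and dims: "CARD('l) < CARD('n)"
    and AS1: "AS1 p f D"
    and AS3: "Lp \<ge> 0" "\<forall>y z. tnorm p (\<lambda>vs. D p y vs - D p z vs) \<le> Lp * norm (y - z)"
    and AS4: "\<kappa>g \<ge> 0" "\<forall>y. norm (grad f y) \<le> \<kappa>g"
    and AS5: "\<kappa>high \<ge> 0" "p = 1 \<Longrightarrow> \<kappa>high = 0"
      "p > 1 \<Longrightarrow> \<forall>y. \<forall>i\<in>{2..p}. \<forall>d. norm d \<le> 1 \<longrightarrow> D i y (\<lambda>_. d) \<ge> - \<kappa>high"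
    and run: "skoffar_run p f D \<nu>0 \<epsilon> \<theta> vth x \<sigma> \<nu> \<mu> \<kappa>S S sh"
    and K1: "\<exists>k\<ge>1. \<nu> k \<ge> 2 * Lp / vth"
  shows "let k1 = (LEAST k. k \<ge> 1 \<and> \<nu> k \<ge> 2 * Lp / vth);
             \<eta> = (\<Sum>i=2..p. (\<kappa>high * fact (p+1) / (fact i * vth * \<nu>0)) powr (1 / real (p - i + 1)));
             \<nu>max = 2 * Lp / vth * (1 + (2 * \<eta> + 2 * (fact (p+1) * \<kappa>g / (vth * \<nu>0)) powr (1 / real p)) ^ (p+1))
         in f (x k1) \<le> f (x 0) + 1 / fact (p+1) * (Lp / \<sigma> 0 * \<nu>max + vth * \<sigma> 0)"
proof -
  let ?F = "fact (p+1) :: real" and ?\<tau> = "2 * Lp / vth"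
  define bound where "bound = 2 * (\<Sum>i=2..p. (\<kappa>high * ?F / (fact i * vth * \<nu>0)) powr (1 / real (p - i + 1)))
    + 2 * (?F * \<kappa>g / (vth * \<nu>0)) powr (1 / real p)"
  define k1 where "k1 = (LEAST k. k \<ge> 1 \<and> \<nu> k \<ge> ?\<tau>)"
  have DT: "deriv_tower p f D" using AS1 by (simp add: AS1_def)
  have params: "0 < vth" "vth < 1" "\<nu> 0 = \<nu>0" "\<nu>0 > 0" "\<sigma> 0 = \<nu>0"
    using run by (simp_all add: skoffar_run_def)
  interpret nu_controlled_descent "\<lambda>k. f (x k)" \<nu> \<sigma> "\<lambda>k. norm (transpose (S k) *v sh k) ^ (p+1)" Lp ?F
    by (rule skoffar_run_descent[OF DT p1 AS3 run])
  note \<sigma>_lower = skoffar_run_sigma_lower[OF run]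
  have high: "\<forall>i\<in>{2..p}. \<forall>d. norm d \<le> 1 \<longrightarrow> D i y (\<lambda>_. d) \<ge> - \<kappa>high" for y
    using AS5(3) by (cases "p > 1") auto
  have "norm (transpose (S k) *v sh k) \<le> bound" for k
    using regularized_step_norm_bound[OF DT p1 _ high AS5(1) skoffar_run_decrease[OF DT run] \<sigma>_lower]
      AS4 params unfolding bound_def by (simp add: mult.assoc)
  moreover have "1 \<le> k1" unfolding k1_def using LeastI_ex[OF K1] by simp
  moreover have "\<nu> k < ?\<tau>" if "1 \<le> k" "k < k1" for k
    using not_less_Least[OF that(2)[unfolded k1_def]] that(1) by auto
  moreover have "?\<tau> \<ge> Lp" using params AS3(1) mult_left_mono[of vth 2 Lp] by (simp add: field_simps)
  ultimately have "f (x k1) \<le> f (x 0) + Lp / \<nu> 0 * (?\<tau> * (1 + bound ^ (p+1))) / ?F"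
    using params by (intro phi_at_threshold power_mono) (auto intro: order_trans[OF _ \<sigma>_lower])
  moreover have "vth * \<sigma> 0 / ?F \<ge> 0" using params by simp
  ultimately show ?thesis
    unfolding Let_def k1_def bound_def params(3,5) by (simp add: add_divide_distrib)
qed

end
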